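(* Let $A\in\mathbb{R}^{N_s\times N_s}$ be the Jacobian matrix, $C\in\mathbb{R}^{N_t\times N_t}$ the BDF2 time-stepping matrix, and $\mathcal{A}=C\otimes I_s-\tau I_t\otimes A$ the all-at-once matrix, all as defined in the context, with $\tau=T/N_t$. Suppose that $\mathrm{Re}(\lambda)\le 0$ for every eigenvalue $\lambda$ of $A$. Then the largest and smallest singular values of $\mathcal{A}$ satisfy $$\sigma_{\max}(\mathcal{A})\le 4+\tau\|A\|_2\quad\text{and}\quad \sigma_{\min}(\mathcal{A})\ge\frac{\sqrt6}{3N_t},$$ so that $$\mathrm{cond}(\mathcal{A})\le 2\sqrt6\,N_t+\frac{\sqrt6\,T\|A\|_2}{2}.$$
   Context: Fix real $a<b$, $T>0$, $\kappa_\gamma>0$, $\gamma\in(1,2)$, and integers $N\ge 2$, $N_t\ge 1$. Put $h=(b-a)/N$, $N_s=N-1$, $\tau=T/N_t$, and let $I_s$, $I_t$ be the identity matrices of order $N_s$, $N_t$ respectively. For $\ell\in\mathbb{Z}$ define $$\omega^{(\gamma)}_\ell=\frac{(-1)^\ell\,\Gamma(1+\gamma)}{\Gamma(1+\gamma/2-\ell)\,\Gamma(1+\gamma/2+\ell)}.$$ The Jacobian matrix is the Toeplitz matrix $A\in\mathbb{R}^{N_s\times N_s}$ with entries $A_{i,j}=-\frac{\kappa_\gamma}{h^\gamma}\,\omega^{(\gamma)}_{i-j}$, $1\le i,j\le N_s$ (the fractional centred difference discretization of $\kappa_\gamma$ times the Riesz derivative of order $\gamma$; it is symmetric negative definite).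 The matrix $C\in\mathbb{R}^{N_t\times N_t}$ has entries $C_{1,1}=1$, $C_{k,k}=\frac32$ for $2\le k\le N_t$, $C_{k,k-1}=-2$ for $2\le k\le N_t$, $C_{k,k-2}=\frac12$ for $3\le k\le N_t$, and zeros elsewhere. $\otimes$ denotes the Kronecker product, $\|\cdot\|_2$ the spectral norm, and $\mathrm{cond}(\mathcal{A})=\sigma_{\max}(\mathcal{A})/\sigma_{\min}(\mathcal{A})$. *)

theory Defs
  imports
    "HOL-Analysis.Gamma_Function"
    "Jordan_Normal_Form.Spectral_Radius"
begin

text \<open>
  Since the sizes of the matrices depend on natural numbers, matrices are those of
  \<^theory>\<open>Jordan_Normal_Form.Matrix\<close>. Their indices start at 0, hence the index shifts below.
\<close>

text \<open>
  The powers \<open>(-1)^l\<close> have integer exponent, hence \<open>powi\<close>. For \<open>\<gamma>\<close> strictly between 1 and 2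
  neither argument of Gamma in the denominator is an integer, so no pole is met.
\<close>

definition riesz_weight :: "real \<Rightarrow> int \<Rightarrow> real" where
  "riesz_weight \<gamma> l =
     (- 1) powi l * Gamma (1 + \<gamma>) /
       (Gamma (1 + \<gamma> / 2 - of_int l) * Gamma (1 + \<gamma> / 2 + of_int l))"

definition jacobian_mat :: "real \<Rightarrow> real \<Rightarrow> real \<Rightarrow> real \<Rightarrow> nat \<Rightarrow> real mat" where
  "jacobian_mat a b \<kappa> \<gamma> N =
     (let h = (b - a) / real N
      in mat (N - 1) (N - 1)
           (\<lambda>(i, j). - (\<kappa> / h powr \<gamma>) * riesz_weight \<gamma> (int i - int j)))"

text \<open>The first step is a backward Euler step, hence the exceptional entry at (0, 0).\<close>

definition bdf2_mat :: "nat \<Rightarrow> real mat" where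
  "bdf2_mat Nt = mat Nt Nt (\<lambda>(i, j).
     if i = j then (if i = 0 then 1 else 3 / 2)
     else if i = j + 1 then - 2
     else if i = j + 2 then 1 / 2
     else 0)"

definition kronecker_prod :: "'a::times mat \<Rightarrow> 'a mat \<Rightarrow> 'a mat" (infixl \<open>\<otimes>\<^sub>K\<close> 72) where
  "A \<otimes>\<^sub>K B = mat (dim_row A * dim_row B) (dim_col A * dim_col B) (\<lambda>(i, j).
     A $$ (i div dim_row B, j div dim_col B) * B $$ (i mod dim_row B, j mod dim_col B))"

definition all_at_once_mat :: "real \<Rightarrow> real mat \<Rightarrow> real mat \<Rightarrow> real mat" where
  "all_at_once_mat \<tau> C A =
     C \<otimes>\<^sub>K 1\<^sub>m (dim_row A) - \<tau> \<cdot>\<^sub>m (1\<^sub>m (dim_row C) \<otimes>\<^sub>K A)"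

definition euclid_norm_vec :: "real vec \<Rightarrow> real" where
  "euclid_norm_vec v = sqrt (v \<bullet> v)"

text \<open>
  The matrix norm induced by the Euclidean vector norm. It is meant for matrices with at least
  one column; otherwise the supremum is over the empty set.
\<close>

definition spectral_norm :: "real mat \<Rightarrow> real" where
  "spectral_norm M =
     (SUP v \<in> carrier_vec (dim_col M) - {0\<^sub>v (dim_col M)}.
        euclid_norm_vec (M *\<^sub>v v) / euclid_norm_vec v)"

text \<open>
  The following are meant for nonempty square matrices. As \<open>M\<^sup>T M\<close> is real symmetric and positive
  semidefinite, all its complex eigenvalues are real and nonnegative, so its real spectrum
  suffices; it is finite and nonempty, so the maximum and minimum are proper.
\<close>

definition singular_values :: "real mat \<Rightarrow> real set" where
  "singular_values M = sqrt ` spectrum (transpose_mat M * M)"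

definition sigma_max :: "real mat \<Rightarrow> real" where
  "sigma_max M = Max (singular_values M)"

definition sigma_min :: "real mat \<Rightarrow> real" where
  "sigma_min M = Min (singular_values M)"

definition cond_number :: "real mat \<Rightarrow> real" where
  "cond_number M = sigma_max M / sigma_min M"

end

theory Submission
  imports Defs
begin

unbundle no vec_syntax
unbundle no inner_syntax

text \<open>
  Write \<open>M = C \<otimes> I - \<tau> K\<close> with \<open>K = I \<otimes> A\<close>. As \<open>A\<close> is symmetric, \<open>K\<close> commutes with \<open>M\<^sup>T M\<close>, so every
  squared singular value \<open>\<sigma>\<^sup>2\<close> of \<open>M\<close> has an eigenvector \<open>w\<close> that is also an eigenvector of \<open>K\<close>, for
  some eigenvalue \<open>\<theta> \<le> 0\<close> of \<open>A\<close>. On \<open>w\<close> the matrix \<open>M\<close> acts as \<open>(C + \<mu> I) \<otimes> I\<close> with \<open>\<mu> = - \<tau> \<theta> \<ge> 0\<close>,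
  and the lower bound for \<open>\<sigma>\<close> reduces to the scalar BDF2 recursion \<open>f = (C + \<mu> I) x\<close>. There a Lyapunov
  function gives \<open>\<bar>x\<^sub>k\<bar> \<le> 3/2 \<bar>f\<^sub>0\<bar> + \<bar>f\<^sub>1\<bar> + \<dots> + \<bar>f\<^sub>k\<bar>\<close>, and Cauchy-Schwarz turns this into
  \<open>\<Sum> x\<^sub>k\<^sup>2 \<le> 3/2 m\<^sup>2 \<Sum> f\<^sub>k\<^sup>2\<close> for \<open>m\<close> steps. The upper bound is the triangle inequality.
\<close>

section \<open>Stability and boundedness of the scalar BDF2 recursion\<close>

text \<open>The product of \<open>C\<close> with x, taken for infinite sequences: \<open>C\<close>
  is lower triangular, so its row k does not depend on the number of steps. Row 1 has no second
  predecessor, which the inner case replaces by 0.\<close>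

definition bdf2_step :: "(nat \<Rightarrow> real) \<Rightarrow> nat \<Rightarrow> real" where
  "bdf2_step x k = (case k of 0 \<Rightarrow> x 0
     | Suc l \<Rightarrow> 3 / 2 * x k - 2 * x l + (case l of 0 \<Rightarrow> 0 | Suc j \<Rightarrow> x j / 2))"

lemma bdf2_first_step_le:
  assumes "\<mu> \<ge> 0"
  shows "\<bar>x 0\<bar> \<le> \<bar>bdf2_step x 0 + \<mu> * x 0\<bar>"
  using assms mult_right_mono[of 1 "1 + \<mu>" "\<bar>x 0\<bar>"]
  by (simp add: bdf2_step_def abs_mult flip: distrib_right[of 1 \<mu>, simplified])

text \<open>
  For \<open>\<mu> = 0\<close> the characteristic roots are 1 and 1/3, and \<open>3 x\<^sub>k - x\<^sub>k\<^sub>-\<^sub>1\<close> is the conserved coordinate;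
  this is where the Lyapunov function \<open>max \<bar>x\<bar> (\<bar>3 x - y\<bar> / 2)\<close> comes from.
\<close>

lemma bdf2_lyapunov_step:
  fixes x y x' f \<mu> B :: real
  assumes "\<mu> \<ge> 0" and x: "\<bar>x\<bar> \<le> B" and d: "\<bar>3 * x - y\<bar> \<le> 2 * B"
    and f: "f = (3 / 2 + \<mu>) * x' - 2 * x + y / 2"
  shows "\<bar>x'\<bar> \<le> B + \<bar>f\<bar>" and "\<bar>3 * x' - x\<bar> \<le> 2 * (B + \<bar>f\<bar>)"
proof -
  have pos: "3 / 2 + \<mu> > 0" using \<open>\<mu> \<ge> 0\<close> by simp
  have B: "0 \<le> B" using x by linarith
  have "(3 / 2 + \<mu>) * \<bar>x'\<bar> = \<bar>(3 / 2 + \<mu>) * x'\<bar>"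
    using pos by (simp add: abs_mult)
  \<comment> \<open>The recursion gives \<open>(3 / 2 + \<mu>) * x' = 2 * x - y / 2 + f\<close>, and
    \<open>2 * x - y / 2\<close> is the mean of \<open>x\<close> and \<open>3 * x - y\<close>, hence
    at most (B + 2 B) / 2 in absolute value.\<close>
  also have "\<dots> = \<bar>(x + (3 * x - y)) / 2 + f\<bar>"
    unfolding f by (rule arg_cong[of _ _ abs]) (simp add: field_simps)
  also have "\<dots> \<le> 3 / 2 * B + \<bar>f\<bar>"
    using abs_triangle_ineq[of "(x + (3 * x - y)) / 2" f] abs_triangle_ineq[of x "3 * x - y"] x d
    by simp
  also have "\<dots> \<le> 3 / 2 * (B + \<bar>f\<bar>) + \<mu> * (B + \<bar>f\<bar>)"
    using mult_nonneg_nonneg[OF \<open>\<mu> \<ge> 0\<close>, of "B + \<bar>f\<bar>"] B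
    by (simp add: field_simps)
  also have "\<dots> = (3 / 2 + \<mu>) * (B + \<bar>f\<bar>)"
    by (simp add: algebra_simps)
  finally show "\<bar>x'\<bar> \<le> B + \<bar>f\<bar>"
    using pos by simp
  have d': "\<bar>3 / 2 * (3 * x - y)\<bar> \<le> 3 * B"
    by (subst abs_mult) (use d in simp)
  have tri: "\<bar>p + q - r\<bar> \<le> \<bar>p\<bar> + \<bar>q\<bar> + \<bar>r\<bar>" for p q r :: real by linarith
  have mx: "\<bar>\<mu> * x\<bar> \<le> \<mu> * B" and mf: "0 \<le> \<mu> * \<bar>f\<bar>" and mB: "0 \<le> \<mu> * B"
    using \<open>\<mu> \<ge> 0\<close> x B by (auto simp: abs_mult mult_left_mono)
  have "(3 / 2 + \<mu>) * \<bar>3 * x' - x\<bar> = \<bar>(3 / 2 + \<mu>) * (3 * x' - x)\<bar>"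
    using pos by (simp add: abs_mult)
  \<comment> \<open>Eliminating \<open>x'\<close> reproduces the old difference with factor exactly
    3/2, so nothing is lost at \<mu> = 0. For \<mu> > 0 the final bound has slack
    \<open>\<mu> * (B + 2 * \<bar>f\<bar>)\<close>.\<close>
  also have "\<dots> = \<bar>3 / 2 * (3 * x - y) + 3 * f - \<mu> * x\<bar>"
    unfolding f by (rule arg_cong[of _ _ abs]) (simp add: field_simps)
  also have "\<dots> \<le> 3 * B + 3 * \<bar>f\<bar> + \<mu> * B"
    by (rule order.trans[OF tri], intro add_mono d' mx) (simp add: abs_mult)
  also have "\<dots> \<le> (3 / 2 + \<mu>) * (2 * (B + \<bar>f\<bar>))"
    using mf mB by (simp add: algebra_simps)
  finally show "\<bar>3 * x' - x\<bar> \<le> 2 * (B + \<bar>f\<bar>)"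
    using pos by simp
qed

text \<open>Iterates \<open>bdf2_lyapunov_step\<close>, with B growing by the size of the new f at
  each step. The weight 3/2 comes from the start: with the missing predecessor set to 0,
  \<open>\<bar>3 * x 0\<bar> \<le> 2 * B\<close> asks for B to be at least
  \<open>3 / 2 * \<bar>x 0\<bar>\<close>. The same convention makes row 1 of \<open>C\<close> an
  instance of the general recursion.\<close>

lemma bdf2_stable_pointwise:
  fixes x f :: "nat \<Rightarrow> real"
  assumes "\<mu> \<ge> 0" and f: "\<And>k. f k = bdf2_step x k + \<mu> * x k"
  shows "\<bar>x k\<bar> \<le> (\<Sum>j\<le>k. (if j = 0 then 3 / 2 else 1) * \<bar>f j\<bar>)
    \<and> \<bar>3 * x k - (case k of 0 \<Rightarrow> 0 | Suc l \<Rightarrow> x l)\<bar>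
        \<le> 2 * (\<Sum>j\<le>k. (if j = 0 then 3 / 2 else 1) * \<bar>f j\<bar>)"
proof (induction k)
  case 0
  have "\<bar>x 0\<bar> \<le> \<bar>f 0\<bar>"
    using bdf2_first_step_le[OF \<open>\<mu> \<ge> 0\<close>] by (simp add: f)
  then show ?case by (simp add: abs_mult)
next
  case (Suc k)
  let ?y = "case k of 0 \<Rightarrow> 0 | Suc l \<Rightarrow> x l"
  have "f (Suc k) = (3 / 2 + \<mu>) * x (Suc k) - 2 * x k + ?y / 2"
    by (simp add: f bdf2_step_def algebra_simps split: nat.split)
  from bdf2_lyapunov_step[OF \<open>\<mu> \<ge> 0\<close> conjunct1[OF Suc] conjunct2[OF Suc] this]
  show ?case by simp
qed

lemma bdf2_stable:
  fixes x f :: "nat \<Rightarrow> real"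
  assumes "\<mu> \<ge> 0" and f: "\<And>k. f k = bdf2_step x k + \<mu> * x k"
  shows "(\<Sum>k<m. (x k)\<^sup>2) \<le> 3 / 2 * (real m)\<^sup>2 * (\<Sum>k<m. (f k)\<^sup>2)"
proof -
  define F where "F = (\<Sum>k<m. (f k)\<^sup>2)"
  \<comment> \<open>For k > 0, \<open>9 / 4 + real k\<close> is the sum of the squared weights of f
    0, ..., f k. The sharper value 1 at k = 0 matters for m = 1, where 9/4 would exceed 3/2.\<close>
  define c :: "nat \<Rightarrow> real" where "c k = (if k = 0 then 1 else 9 / 4 + real k)" for k
  have F: "F \<ge> 0" unfolding F_def by (simp add: sum_nonneg)
  have "(x k)\<^sup>2 \<le> c k * F" if "k < m" for k
  proof (cases "k = 0")
    case True
    have "\<bar>x 0\<bar> \<le> \<bar>f 0\<bar>"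
      using bdf2_first_step_le[OF \<open>\<mu> \<ge> 0\<close>] by (simp add: f)
    then have "(x 0)\<^sup>2 \<le> (f 0)\<^sup>2" by (simp add: abs_le_square_iff)
    also have "\<dots> \<le> F"
      unfolding F_def using that True by (intro member_le_sum) auto
    finally show ?thesis by (simp add: True c_def)
  next
    case False
    let ?a = "\<lambda>j::nat. if j = 0 then 3 / 2 else 1 :: real"
    have a: "(\<Sum>j\<le>n. (?a j)\<^sup>2) = 9 / 4 + real n" for n
      by (induction n) (auto simp: power2_eq_square)
    have "(x k)\<^sup>2 \<le> (\<Sum>j\<le>k. ?a j * \<bar>f j\<bar>)\<^sup>2"
      using conjunct1[OF bdf2_stable_pointwise[OF assms, of k]] power_mono[of "\<bar>x k\<bar>" _ 2]
      by fastforce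
    also have "\<dots> \<le> (\<Sum>j\<le>k. (?a j)\<^sup>2) * (\<Sum>j\<le>k. \<bar>f j\<bar>\<^sup>2)"
      by (rule Cauchy_Schwarz_ineq_sum)
    also have "\<dots> \<le> (9 / 4 + real k) * F"
      unfolding a F_def using that by (intro mult_left_mono) (auto intro!: sum_mono2)
    finally show ?thesis using False by (simp add: c_def)
  qed
  then have "(\<Sum>k<m. (x k)\<^sup>2) \<le> (\<Sum>k<m. c k) * F"
    unfolding sum_distrib_right by (intro sum_mono) simp
  \<comment> \<open>For k > 0 the summand 9/4 + k is at most 3/2 (2 k + 1), the increment of the
    right-hand side.\<close>
  also have "(\<Sum>k<m. c k) \<le> 3 / 2 * (real m)\<^sup>2"
    by (induction m) (auto simp: c_def power2_eq_square algebra_simps)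
  finally show ?thesis using F by (simp add: F_def mult_right_mono)
qed

text \<open>The absolute coefficients 3/2, 2 and 1/2 add up to 4. Cauchy-Schwarz weighted with them
  gives the factors 6, 8 and 2, each four times a coefficient, and shifting a sequence by one or two
  places only drops squares from the sum.\<close>

lemma bdf2_step_square_sum_le:
  "(\<Sum>k<m. (bdf2_step x k)\<^sup>2) \<le> 16 * (\<Sum>k<m. (x k)\<^sup>2)"
proof -
  define y where "y k = (case k of 0 \<Rightarrow> 0 | Suc l \<Rightarrow> (x l)\<^sup>2)" for k
  define z where "z k = (case k of 0 \<Rightarrow> 0 | Suc l \<Rightarrow> y l)" for k
  have sy: "(\<Sum>k<m. y k) \<le> (\<Sum>k<m. (x k)\<^sup>2)"
  proof (cases m)
    case (Suc n)
    then show ?thesis unfolding Suc sum.lessThan_Suc_shift[of y] by (simp add: y_def)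
  qed simp
  have y: "y k \<ge> 0" for k by (simp add: y_def split: nat.split)
  have "(\<Sum>k<m. z k) \<le> (\<Sum>k<m. y k)"
  proof (cases m)
    case (Suc n)
    then show ?thesis unfolding Suc sum.lessThan_Suc_shift[of z] by (simp add: z_def y)
  qed simp
  with sy have sz: "(\<Sum>k<m. z k) \<le> (\<Sum>k<m. (x k)\<^sup>2)" by simp
  have cs: "(3 / 2 * p - 2 * q + r / 2)\<^sup>2 \<le> 6 * p\<^sup>2 + 8 * q\<^sup>2 + 2 * r\<^sup>2" for p q r :: real
  proof -
    \<comment> \<open>Lagrange's identity: the defect in Cauchy-Schwarz is a sum of squares weighted
      with products of two coefficients.\<close>
    have "6 * p\<^sup>2 + 8 * q\<^sup>2 + 2 * r\<^sup>2 - (3 / 2 * p - 2 * q + r / 2)\<^sup>2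
        = 3 * (p + q)\<^sup>2 + 3 / 4 * (p - r)\<^sup>2 + (q + r)\<^sup>2"
      by (simp add: power2_eq_square field_simps)
    also have "\<dots> \<ge> 0" by simp
    finally show ?thesis by simp
  qed
  have "(bdf2_step x k)\<^sup>2 \<le> 6 * (x k)\<^sup>2 + 8 * y k + 2 * z k" for k
    using cs[of "x k" "x (k - 1)" "case k - 1 of 0 \<Rightarrow> 0 | Suc j \<Rightarrow> x j"]
    by (auto simp: bdf2_step_def y_def z_def split: nat.split)
  then have "(\<Sum>k<m. (bdf2_step x k)\<^sup>2) \<le> (\<Sum>k<m. 6 * (x k)\<^sup>2 + 8 * y k + 2 * z k)"
    by (rule sum_mono)
  also have "\<dots> = 6 * (\<Sum>k<m. (x k)\<^sup>2) + 8 * (\<Sum>k<m. y k) + 2 * (\<Sum>k<m. z k)"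
    by (simp add: sum.distrib sum_distrib_left)
  finally show ?thesis using sy sz by linarith
qed

section \<open>Joint eigenvectors of commuting matrices\<close>

text \<open>
  In coordinates that make \<open>A\<close> upper triangular, subtracting the diagonal entry at the last nonzero
  coordinate of a vector kills that coordinate, so the process ends in an eigenvector.
\<close>

lemma invariant_set_contains_eigenvector:
  fixes A :: "complex mat"
  assumes A: "A \<in> carrier_mat n n" and S: "S \<subseteq> carrier_vec n"
    and inv: "\<And>x z. x \<in> S \<Longrightarrow> A *\<^sub>v x - z \<cdot>\<^sub>v x \<in> S"
    and v: "v \<in> S" "v \<noteq> 0\<^sub>v n"
  shows "\<exists>w\<in>S. \<exists>z. eigenvector A w z"
proof -
  obtain es where "char_poly A = (\<Prod>a\<leftarrow>es. [:- a, 1:])"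
    using char_poly_factorized[OF A] by blast
  then obtain U where U: "U \<in> carrier_mat n n" "upper_triangular U" "similar_mat A U"
    using schur_decomposition_exists[OF A] by blast
  from U(3) obtain P Q where "similar_mat_wit A U P Q"
    unfolding similar_mat_def by blast
  from similar_mat_witD2[OF A this]
  have PQ: "P * Q = 1\<^sub>m n" "Q * P = 1\<^sub>m n" "A = P * U * Q"
    and P: "P \<in> carrier_mat n n" and Q: "Q \<in> carrier_mat n n" by auto
  have QA: "Q *\<^sub>v (A *\<^sub>v x) = U *\<^sub>v (Q *\<^sub>v x)" if x: "x \<in> carrier_vec n" for x
  proof -
    have "Q *\<^sub>v (A *\<^sub>v x) = (Q * A) *\<^sub>v x" using A Q x by simp
    also have "Q * A = Q * P * (U * Q)"
      using P Q U(1) PQ(3) by (simp add: assoc_mult_mat[of _ n n _ n _ n])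
    also have "\<dots> = U * Q" using PQ(2) U(1) Q by simp
    finally show ?thesis using U(1) Q x by simp
  qed
  \<comment> \<open>Induction on m, a bound on the number of leading coordinates of
    \<open>Q *\<^sub>v v\<close> that may be nonzero: m = n demands nothing, and m = 0 contradicts
    that v is nonzero.\<close>
  have "\<exists>w\<in>S. \<exists>z. eigenvector A w z"
    if "m \<le> n" "v \<in> S" "v \<noteq> 0\<^sub>v n" "\<forall>i. m \<le> i \<and> i < n \<longrightarrow> (Q *\<^sub>v v) $ i = 0" for m v
    using that
  proof (induction m arbitrary: v)
    case 0
    have v: "v \<in> carrier_vec n" using 0 S by blast
    have "Q *\<^sub>v v = 0\<^sub>v n" using 0 Q by (intro eq_vecI) auto
    then have "P *\<^sub>v (Q *\<^sub>v v) = 0\<^sub>v n" using P by (intro eq_vecI) auto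
    moreover have "P *\<^sub>v (Q *\<^sub>v v) = v"
      using PQ(1) P Q v by (metis assoc_mult_mat_vec one_mult_mat_vec)
    ultimately show ?case using 0 by simp
  next
    case (Suc m)
    have v: "v \<in> carrier_vec n" using Suc.prems S by blast
    define w where "w = A *\<^sub>v v - U $$ (m, m) \<cdot>\<^sub>v v"
    have wS: "w \<in> S" using inv Suc.prems w_def by blast
    show ?case
    proof (cases "w = 0\<^sub>v n")
      case True
      have "A *\<^sub>v v = U $$ (m, m) \<cdot>\<^sub>v v"
      proof (rule eq_vecI)
        fix i assume i: "i < dim_vec (U $$ (m, m) \<cdot>\<^sub>v v)"
        then have "w $ i = 0" using True v by simp
        then show "(A *\<^sub>v v) $ i = (U $$ (m, m) \<cdot>\<^sub>v v) $ i"
          using i A v unfolding w_def by simp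
      qed (use A v in simp)
      then have "eigenvector A v (U $$ (m, m))"
        using A v Suc.prems unfolding eigenvector_def by simp
      then show ?thesis using Suc.prems by blast
    next
      case False
      have Qw: "Q *\<^sub>v w = U *\<^sub>v (Q *\<^sub>v v) - U $$ (m, m) \<cdot>\<^sub>v (Q *\<^sub>v v)"
        unfolding w_def QA[OF v, symmetric]
        using A Q v by (simp add: mult_minus_distrib_mat_vec[of _ n n] mult_mat_vec[of _ n n])
      have "(Q *\<^sub>v w) $ i = 0" if i: "m \<le> i" "i < n" for i
      proof -
        have "(U *\<^sub>v (Q *\<^sub>v v)) $ i = (\<Sum>j<n. U $$ (i, j) * (Q *\<^sub>v v) $ j)"
          using U(1) Q i by (simp add: scalar_prod_def atLeast0LessThan)
        \<comment> \<open>Only j = m survives: for j < m the entry of U lies below the diagonal, and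
          for j > m the coordinate vanishes by assumption. The shift cancels the surviving term if i
          = m, and triangularity makes it 0 if i > m.\<close>
        also have "\<dots> = (\<Sum>j<n. if j = m then U $$ (i, m) * (Q *\<^sub>v v) $ m else 0)"
        proof (rule sum.cong)
          fix j assume "j \<in> {..<n}"
          then show "U $$ (i, j) * (Q *\<^sub>v v) $ j
              = (if j = m then U $$ (i, m) * (Q *\<^sub>v v) $ m else 0)"
            using Suc.prems(4) upper_triangularD[OF U(2), of j i] U(1) i
            by (cases "j < m") auto
        qed simp
        also have "\<dots> = U $$ (i, m) * (Q *\<^sub>v v) $ m" using i by simp
        finally show ?thesis
          using Qw i Q U Suc.prems(4) upper_triangularD[OF U(2), of m i]
          by (cases "i = m") auto
      qed
      then show ?thesis using Suc.IH[of w] Suc.prems(1) wS False by simp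
    qed
  qed
  moreover have "\<forall>i. n \<le> i \<and> i < n \<longrightarrow> (Q *\<^sub>v v) $ i = 0" by auto
  ultimately show ?thesis using v by blast
qed

lemma map_mat_of_real_mult_vec:
  assumes "K \<in> carrier_mat n n" "w \<in> carrier_vec n"
  shows "map_vec Re (map_mat complex_of_real K *\<^sub>v w) = K *\<^sub>v map_vec Re w"
    and "map_vec Im (map_mat complex_of_real K *\<^sub>v w) = K *\<^sub>v map_vec Im w"
  using assms by (auto intro!: eq_vecI simp: scalar_prod_def)

lemma scalar_prod_self_pos:
  fixes v :: "real vec"
  assumes "v \<in> carrier_vec n" "v \<noteq> 0\<^sub>v n"
  shows "v \<bullet> v > 0"
proof -
  have "v \<bullet> v \<ge> 0" by (simp add: scalar_prod_def sum_nonneg)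
  moreover have "v \<bullet> v \<noteq> 0"
  proof
    assume "v \<bullet> v = 0"
    then have "\<forall>i<dim_vec v. v $ i = 0"
      by (simp add: scalar_prod_def sum_nonneg_eq_0_iff)
    then have "v = 0\<^sub>v n" using assms(1) by (intro eq_vecI) auto
    with assms(2) show False by simp
  qed
  ultimately show ?thesis by simp
qed

lemma map_vec_Re_Im_nonzero:
  assumes "w \<in> carrier_vec n" "w \<noteq> 0\<^sub>v n"
  shows "map_vec Re w \<noteq> 0\<^sub>v n \<or> map_vec Im w \<noteq> 0\<^sub>v n"
proof (rule ccontr)
  assume "\<not> ?thesis"
  then have 0: "map_vec Re w = 0\<^sub>v n" "map_vec Im w = 0\<^sub>v n" by auto
  have "w $ i = 0" if "i < n" for i
    using arg_cong[OF 0(1), of "\<lambda>v. v $ i"] arg_cong[OF 0(2), of "\<lambda>v. v $ i"] assms(1) that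
    by (simp add: complex_eq_iff)
  then have "w = 0\<^sub>v n" using assms(1) by (intro eq_vecI) auto
  with assms(2) show False by simp
qed

text \<open>With x and y the real and imaginary parts of w, symmetry equates
  \<open>(K *\<^sub>v x) \<bullet> y\<close> and \<open>x \<bullet> (K *\<^sub>v y)\<close>. The
  terms with Re z cancel, and what remains is Im z times a positive number.\<close>

lemma symmetric_eigenvalue_real:
  fixes K :: "real mat"
  assumes K: "K \<in> carrier_mat n n" and sym: "transpose_mat K = K"
    and w: "w \<in> carrier_vec n" "w \<noteq> 0\<^sub>v n"
    and ev: "map_mat complex_of_real K *\<^sub>v w = z \<cdot>\<^sub>v w"
  shows "Im z = 0"
proof -
  let ?x = "map_vec Re w" and ?y = "map_vec Im w"
  have x: "?x \<in> carrier_vec n" and y: "?y \<in> carrier_vec n" using w by auto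
  have "K *\<^sub>v ?x = map_vec Re (z \<cdot>\<^sub>v w)" "K *\<^sub>v ?y = map_vec Im (z \<cdot>\<^sub>v w)"
    using map_mat_of_real_mult_vec[OF K w(1)] ev by auto
  then have Kx: "K *\<^sub>v ?x = Re z \<cdot>\<^sub>v ?x - Im z \<cdot>\<^sub>v ?y"
    and Ky: "K *\<^sub>v ?y = Re z \<cdot>\<^sub>v ?y + Im z \<cdot>\<^sub>v ?x"
    using w by (auto intro!: eq_vecI)
  have "(K *\<^sub>v ?x) \<bullet> ?y = ?x \<bullet> (K *\<^sub>v ?y)"
    using transpose_vec_mult_scalar[OF K y x] sym comm_scalar_prod[OF x y] 
      comm_scalar_prod[of "K *\<^sub>v ?x" n ?y] comm_scalar_prod[of "K *\<^sub>v ?y" n ?x] K x y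
    by (metis mult_mat_vec_carrier)
  then have "Im z * (?x \<bullet> ?x + ?y \<bullet> ?y) = 0"
    unfolding Kx Ky using x y
    by (simp add: minus_scalar_prod_distrib[of _ n] scalar_prod_add_distrib[of _ n] algebra_simps)
  moreover have "?x \<bullet> ?x + ?y \<bullet> ?y > 0"
  proof -
    show ?thesis
      using map_vec_Re_Im_nonzero[OF w] scalar_prod_self_pos[OF x] scalar_prod_self_pos[OF y] x y
      by (metis add_pos_nonneg add_nonneg_pos less_imp_le scalar_prod_left_zero order_refl)
  qed
  ultimately show ?thesis by simp
qed

text \<open>Commutation makes the complexified eigenspace of \<open>G\<close> invariant under
  \<open>K\<close>, so it contains an eigenvector of \<open>K\<close>. Its eigenvalue is real by
  symmetry, so its real and imaginary parts satisfy both eigenvalue equations, and one of them is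
  nonzero.\<close>

lemma commuting_symmetric_joint_eigenvector:
  fixes G K :: "real mat"
  assumes G: "G \<in> carrier_mat n n" and K: "K \<in> carrier_mat n n"
    and sym: "transpose_mat K = K" and comm: "G * K = K * G" and ev: "eigenvalue G \<mu>"
  obtains w \<theta> where "eigenvector G w \<mu>" "eigenvector K w \<theta>"
proof -
  let ?c = "map_mat complex_of_real"
  have cG: "?c G \<in> carrier_mat n n" and cK: "?c K \<in> carrier_mat n n" using G K by auto
  have ccomm: "?c G * ?c K = ?c K * ?c G"
    using comm G K by (metis of_real_hom.mat_hom_mult)
  define S where "S = {x \<in> carrier_vec n. ?c G *\<^sub>v x = complex_of_real \<mu> \<cdot>\<^sub>v x}"
  obtain v where "eigenvector G v \<mu>" using ev unfolding eigenvalue_def by blast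
  then have "eigenvector (?c G) (map_vec complex_of_real v) (complex_of_real \<mu>)"
    by (rule of_real_hom.eigenvector_hom[OF G])
  then have v: "map_vec complex_of_real v \<in> S" "map_vec complex_of_real v \<noteq> 0\<^sub>v n"
    using G unfolding eigenvector_def S_def by auto
  have "?c K *\<^sub>v x - z \<cdot>\<^sub>v x \<in> S" if "x \<in> S" for x z
  proof -
    have x: "x \<in> carrier_vec n" and Gx: "?c G *\<^sub>v x = complex_of_real \<mu> \<cdot>\<^sub>v x"
      using that unfolding S_def by auto
    have Kx: "?c K *\<^sub>v x \<in> carrier_vec n" using cK x by (rule mult_mat_vec_carrier)
    have "?c G *\<^sub>v (?c K *\<^sub>v x) = ?c K *\<^sub>v (?c G *\<^sub>v x)"
      using ccomm assoc_mult_mat_vec[OF cG cK x] assoc_mult_mat_vec[OF cK cG x] by simp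
    also have "\<dots> = complex_of_real \<mu> \<cdot>\<^sub>v (?c K *\<^sub>v x)"
      unfolding Gx by (rule mult_mat_vec[OF cK x])
    finally have GKx: "?c G *\<^sub>v (?c K *\<^sub>v x) = complex_of_real \<mu> \<cdot>\<^sub>v (?c K *\<^sub>v x)" .
    have "?c G *\<^sub>v (?c K *\<^sub>v x - z \<cdot>\<^sub>v x) = ?c G *\<^sub>v (?c K *\<^sub>v x) - ?c G *\<^sub>v (z \<cdot>\<^sub>v x)"
      using Kx x by (intro mult_minus_distrib_mat_vec[OF cG]) auto
    also have "\<dots> = complex_of_real \<mu> \<cdot>\<^sub>v (?c K *\<^sub>v x) - z \<cdot>\<^sub>v (complex_of_real \<mu> \<cdot>\<^sub>v x)"
      unfolding GKx mult_mat_vec[OF cG x] Gx ..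
    also have "\<dots> = complex_of_real \<mu> \<cdot>\<^sub>v (?c K *\<^sub>v x - z \<cdot>\<^sub>v x)"
      using Kx x cK by (intro eq_vecI) (auto simp: algebra_simps simp del: index_mult_mat_vec)
    finally show ?thesis using Kx x unfolding S_def by simp
  qed
  from invariant_set_contains_eigenvector[OF cK _ this v]
  obtain w z where w: "w \<in> S" and ew: "eigenvector (?c K) w z"
    unfolding S_def by auto
  have w': "w \<in> carrier_vec n" "w \<noteq> 0\<^sub>v n" and Kw: "?c K *\<^sub>v w = z \<cdot>\<^sub>v w"
    using ew K unfolding eigenvector_def by auto
  have Gw: "?c G *\<^sub>v w = complex_of_real \<mu> \<cdot>\<^sub>v w" using w unfolding S_def by simp
  have z: "Im z = 0" by (rule symmetric_eigenvalue_real[OF K sym w' Kw])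
  let ?x = "map_vec Re w" and ?y = "map_vec Im w"
  have "K *\<^sub>v ?x = Re z \<cdot>\<^sub>v ?x" "K *\<^sub>v ?y = Re z \<cdot>\<^sub>v ?y"
    "G *\<^sub>v ?x = \<mu> \<cdot>\<^sub>v ?x" "G *\<^sub>v ?y = \<mu> \<cdot>\<^sub>v ?y"
    using w' z
    by (auto intro!: eq_vecI simp: Kw Gw simp flip: map_mat_of_real_mult_vec[OF K w'(1)]
        map_mat_of_real_mult_vec[OF G w'(1)])
  then have ex: "eigenvector G x \<mu> \<and> eigenvector K x (Re z)" if "x \<noteq> 0\<^sub>v n" "x \<in> {?x, ?y}" for x
    using that w' G K by (auto simp: eigenvector_def)
  show ?thesis
    using map_vec_Re_Im_nonzero[OF w'] ex that by blast
qed

text \<open>The joint eigenvector with \<open>G\<close> the identity. Applied to a Gram matrix, it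
  shows that there are singular values at all.\<close>

lemma symmetric_eigenvalue_exists:
  fixes K :: "real mat"
  assumes K: "K \<in> carrier_mat n n" and sym: "transpose_mat K = K" and "n > 0"
  shows "\<exists>\<theta>. eigenvalue K \<theta>"
proof -
  have "eigenvector (1\<^sub>m n) (unit_vec n 0) (1::real)"
    using \<open>n > 0\<close> by (auto simp: eigenvector_def)
  then have "eigenvalue (1\<^sub>m n) (1::real)" unfolding eigenvalue_def by blast
  from commuting_symmetric_joint_eigenvector[OF _ K sym _ this] K
  obtain w \<theta> where "eigenvector K w \<theta>" by (metis left_mult_one_mat one_carrier_mat right_mult_one_mat)
  then show ?thesis unfolding eigenvalue_def by blast
qed

text \<open>Turns singular values, defined through the spectrum of the Gram matrix, into factors by
  which \<open>M\<close> stretches vectors.\<close>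

lemma eigenvector_gram:
  fixes M :: "real mat"
  assumes M: "M \<in> carrier_mat n n" and "eigenvector (transpose_mat M * M) v \<mu>"
  shows "(M *\<^sub>v v) \<bullet> (M *\<^sub>v v) = \<mu> * (v \<bullet> v)"
proof -
  have v: "v \<in> carrier_vec n" and ev: "(transpose_mat M * M) *\<^sub>v v = \<mu> \<cdot>\<^sub>v v"
    using assms by (auto simp: eigenvector_def)
  have Mv: "M *\<^sub>v v \<in> carrier_vec n" using M v by (rule mult_mat_vec_carrier)
  have "(M *\<^sub>v v) \<bullet> (M *\<^sub>v v) = (transpose_mat M *\<^sub>v (M *\<^sub>v v)) \<bullet> v"
    by (rule transpose_vec_mult_scalar[OF M v Mv, symmetric])
  also have "transpose_mat M *\<^sub>v (M *\<^sub>v v) = \<mu> \<cdot>\<^sub>v v"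
    using ev M v by (metis assoc_mult_mat_vec transpose_carrier_mat)
  finally show ?thesis using v by simp
qed

section \<open>Kronecker products in block indices, and the rows of the BDF2 matrix\<close>

lemma sum_lessThan_mult:
  fixes f :: "nat \<Rightarrow> 'a::comm_monoid_add"
  shows "(\<Sum>q<m * n. f q) = (\<Sum>j<m. \<Sum>t<n. f (j * n + t))"
  unfolding sum.nat_group[symmetric]
  by (rule sum.cong) (simp_all add: sum.atLeastLessThan_shift_0 atLeast0LessThan)

lemma mult_add_less_mult:
  fixes k s m n :: nat
  assumes "k < m" "s < n"
  shows "k * n + s < m * n"
proof -
  have "k * n + s < Suc k * n" using assms(2) by simp
  also have "\<dots> \<le> m * n" using assms(1) by (intro mult_le_mono1) simp
  finally show ?thesis .
qed

lemma kronecker_prod_carrier [simp]: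
  "X \<in> carrier_mat m p \<Longrightarrow> Y \<in> carrier_mat n q \<Longrightarrow> X \<otimes>\<^sub>K Y \<in> carrier_mat (m * n) (p * q)"
  by (simp add: kronecker_prod_def)

lemma index_kronecker_prod:
  assumes "X \<in> carrier_mat m p" "Y \<in> carrier_mat n q" "i < m * n" "j < p * q"
  shows "(X \<otimes>\<^sub>K Y) $$ (i, j) = X $$ (i div n, j div q) * Y $$ (i mod n, j mod q)"
  using assms by (simp add: kronecker_prod_def)

lemma index_kronecker_prod_mult_vec:
  fixes X Y :: "'a::comm_semiring_0 mat"
  assumes X: "X \<in> carrier_mat m p" and Y: "Y \<in> carrier_mat n q"
    and v: "v \<in> carrier_vec (p * q)" and "k < m" "s < n"
  shows "((X \<otimes>\<^sub>K Y) *\<^sub>v v) $ (k * n + s)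
    = (\<Sum>j<p. \<Sum>t<q. X $$ (k, j) * Y $$ (s, t) * v $ (j * q + t))"
proof -
  have i: "k * n + s < m * n" using \<open>k < m\<close> \<open>s < n\<close> by (rule mult_add_less_mult)
  have XY: "X \<otimes>\<^sub>K Y \<in> carrier_mat (m * n) (p * q)" using X Y by simp
  have "((X \<otimes>\<^sub>K Y) *\<^sub>v v) $ (k * n + s)
      = (\<Sum>r<p * q. (X \<otimes>\<^sub>K Y) $$ (k * n + s, r) * v $ r)"
    using XY v i by (simp add: scalar_prod_def atLeast0LessThan)
  also have "\<dots> = (\<Sum>j<p. \<Sum>t<q. X $$ (k, j) * Y $$ (s, t) * v $ (j * q + t))"
    unfolding sum_lessThan_mult
  proof (intro sum.cong refl)
    fix j t assume "j \<in> {..<p}" "t \<in> {..<q}"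
    then show "(X \<otimes>\<^sub>K Y) $$ (k * n + s, j * q + t) * v $ (j * q + t)
        = X $$ (k, j) * Y $$ (s, t) * v $ (j * q + t)"
      using index_kronecker_prod[OF X Y i, of "j * q + t"] mult_add_less_mult[of j p t q] \<open>s < n\<close>
      by simp
  qed
  finally show ?thesis .
qed

text \<open>With h = a q + b the sum over h factors into a sum over a and one over b. The rule
  serves to commute \<open>X \<otimes>\<^sub>K 1\<^sub>m n\<close> with
  \<open>1\<^sub>m m \<otimes>\<^sub>K A\<close>.\<close>

lemma kronecker_prod_mult:
  fixes X Y X' Y' :: "'a::comm_semiring_0 mat"
  assumes X: "X \<in> carrier_mat m p" and Y: "Y \<in> carrier_mat n q"
    and X': "X' \<in> carrier_mat p r" and Y': "Y' \<in> carrier_mat q u"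
  shows "(X \<otimes>\<^sub>K Y) * (X' \<otimes>\<^sub>K Y') = (X * X') \<otimes>\<^sub>K (Y * Y')"
proof (rule eq_matI)
  have XY: "X \<otimes>\<^sub>K Y \<in> carrier_mat (m * n) (p * q)" using X Y by simp
  have XY': "X' \<otimes>\<^sub>K Y' \<in> carrier_mat (p * q) (r * u)" using X' Y' by simp
  have XX: "X * X' \<in> carrier_mat m r" and YY: "Y * Y' \<in> carrier_mat n u"
    using X X' Y Y' by auto
  show "dim_row ((X \<otimes>\<^sub>K Y) * (X' \<otimes>\<^sub>K Y')) = dim_row ((X * X') \<otimes>\<^sub>K (Y * Y'))"
    "dim_col ((X \<otimes>\<^sub>K Y) * (X' \<otimes>\<^sub>K Y')) = dim_col ((X * X') \<otimes>\<^sub>K (Y * Y'))"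
    by (simp_all add: kronecker_prod_def)
  fix i j
  assume "i < dim_row ((X * X') \<otimes>\<^sub>K (Y * Y'))" "j < dim_col ((X * X') \<otimes>\<^sub>K (Y * Y'))"
  then have i: "i < m * n" and j: "j < r * u"
    using X Y X' Y' by (simp_all add: kronecker_prod_def)
  have "0 < n" "0 < u" using i j by (auto intro: gr0I)
  then have div: "i div n < m" "i mod n < n" "j div u < r" "j mod u < u"
    using i j by (auto simp: less_mult_imp_div_less)
  have "((X \<otimes>\<^sub>K Y) * (X' \<otimes>\<^sub>K Y')) $$ (i, j)
      = (\<Sum>h<p * q. (X \<otimes>\<^sub>K Y) $$ (i, h) * (X' \<otimes>\<^sub>K Y') $$ (h, j))"
    using XY XY' i j by (simp add: scalar_prod_def atLeast0LessThan)
  also have "\<dots> = (\<Sum>a<p. \<Sum>b<q. (X $$ (i div n, a) * X' $$ (a, j div u))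
      * (Y $$ (i mod n, b) * Y' $$ (b, j mod u)))"
    unfolding sum_lessThan_mult
  proof (intro sum.cong refl)
    fix a b assume "a \<in> {..<p}" "b \<in> {..<q}"
    then show "(X \<otimes>\<^sub>K Y) $$ (i, a * q + b) * (X' \<otimes>\<^sub>K Y') $$ (a * q + b, j)
        = (X $$ (i div n, a) * X' $$ (a, j div u)) * (Y $$ (i mod n, b) * Y' $$ (b, j mod u))"
      using index_kronecker_prod[OF X Y i, of "a * q + b"]
        index_kronecker_prod[OF X' Y' _ j, of "a * q + b"] mult_add_less_mult[of a p b q]
      by (simp add: ac_simps)
  qed
  also have "\<dots> = (X * X') $$ (i div n, j div u) * (Y * Y') $$ (i mod n, j mod u)"
    using X X' Y Y' div by (simp add: scalar_prod_def atLeast0LessThan sum_product)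
  also have "\<dots> = ((X * X') \<otimes>\<^sub>K (Y * Y')) $$ (i, j)"
    by (rule index_kronecker_prod[OF XX YY i j, symmetric])
  finally show "((X \<otimes>\<^sub>K Y) * (X' \<otimes>\<^sub>K Y')) $$ (i, j) = ((X * X') \<otimes>\<^sub>K (Y * Y')) $$ (i, j)" .
qed

lemma transpose_kronecker_prod:
  "transpose_mat (X \<otimes>\<^sub>K Y) = transpose_mat X \<otimes>\<^sub>K transpose_mat Y"
proof (rule eq_matI)
  fix i j
  assume "i < dim_row (transpose_mat X \<otimes>\<^sub>K transpose_mat Y)"
    "j < dim_col (transpose_mat X \<otimes>\<^sub>K transpose_mat Y)"
  then have ij: "i < dim_col X * dim_col Y" "j < dim_row X * dim_row Y"
    by (auto simp: kronecker_prod_def)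
  then have "0 < dim_col Y" "0 < dim_row Y" by (auto intro: gr0I)
  then show "transpose_mat (X \<otimes>\<^sub>K Y) $$ (i, j) = (transpose_mat X \<otimes>\<^sub>K transpose_mat Y) $$ (i, j)"
    using ij by (simp add: kronecker_prod_def less_mult_imp_div_less)
qed (simp_all add: kronecker_prod_def)

lemma bdf2_mat_carrier [simp]: "bdf2_mat m \<in> carrier_mat m m"
  by (simp add: bdf2_mat_def)

lemma sum_bdf2_mat:
  assumes "k < m"
  shows "(\<Sum>j<m. bdf2_mat m $$ (k, j) * x j) = bdf2_step x k"
proof -
  have "(\<Sum>j<m. bdf2_mat m $$ (k, j) * x j)
      = (\<Sum>j<m. (if j = k then (if k = 0 then 1 else 3 / 2) * x j else 0)
          + (if Suc j = k then - 2 * x j else 0) + (if Suc (Suc j) = k then x j / 2 else 0))"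
    using assms by (intro sum.cong) (auto simp: bdf2_mat_def)
  also have "\<dots> = bdf2_step x k"
    using assms unfolding sum.distrib by (auto simp: bdf2_step_def split: nat.split)
  finally show ?thesis .
qed

section \<open>Euclidean norm and spectral norm\<close>

lemma scalar_prod_self_eq_sum:
  fixes v :: "real vec"
  assumes "v \<in> carrier_vec n"
  shows "v \<bullet> v = (\<Sum>i<n. (v $ i)\<^sup>2)"
  using assms by (simp add: scalar_prod_def atLeast0LessThan power2_eq_square)

lemma euclid_norm_vec_eq_L2_set:
  "v \<in> carrier_vec n \<Longrightarrow> euclid_norm_vec v = L2_set (\<lambda>i. v $ i) {..<n}"
  by (simp add: euclid_norm_vec_def L2_set_def scalar_prod_self_eq_sum)

lemma euclid_norm_vec_nonneg: "euclid_norm_vec v \<ge> 0"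
  by (simp add: euclid_norm_vec_def scalar_prod_def sum_nonneg)

lemma euclid_norm_vec_square: "(euclid_norm_vec v)\<^sup>2 = v \<bullet> v"
  by (simp add: euclid_norm_vec_def scalar_prod_def sum_nonneg)

lemma euclid_norm_vec_minus_smult_le:
  assumes u: "u \<in> carrier_vec n" and v: "v \<in> carrier_vec n" and "c \<ge> 0"
  shows "euclid_norm_vec (u - c \<cdot>\<^sub>v v) \<le> euclid_norm_vec u + c * euclid_norm_vec v"
proof -
  have "euclid_norm_vec (u - c \<cdot>\<^sub>v v) = L2_set (\<lambda>i. u $ i + - c * v $ i) {..<n}"
    using u v by (subst euclid_norm_vec_eq_L2_set[of _ n]) (auto intro!: L2_set_cong)
  also have "\<dots> \<le> L2_set (\<lambda>i. u $ i) {..<n} + L2_set (\<lambda>i. - c * v $ i) {..<n}"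
    by (rule L2_set_triangle_ineq)
  also have "L2_set (\<lambda>i. - c * v $ i) {..<n} = L2_set (\<lambda>i. c * v $ i) {..<n}"
    by (simp add: L2_set_def)
  also have "\<dots> = c * L2_set (\<lambda>i. v $ i) {..<n}"
    using \<open>c \<ge> 0\<close> by (simp add: L2_set_right_distrib)
  finally show ?thesis using u v by (simp add: euclid_norm_vec_eq_L2_set)
qed

text \<open>A real supremum dominates its members only if they are bounded above. Cauchy-Schwarz in
  each row bounds the quotients by the Frobenius norm \<open>sqrt F\<close>.\<close>

lemma spectral_norm_bound:
  assumes M: "M \<in> carrier_mat m n" and x: "x \<in> carrier_vec n"
  shows "euclid_norm_vec (M *\<^sub>v x) \<le> spectral_norm M * euclid_norm_vec x"
proof (cases "x = 0\<^sub>v n")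
  case True
  then have "M *\<^sub>v x = 0\<^sub>v m" using M by (intro eq_vecI) auto
  then show ?thesis using True by (simp add: euclid_norm_vec_def)
next
  case False
  define q where "q v = euclid_norm_vec (M *\<^sub>v v) / euclid_norm_vec v" for v
  define F where "F = (\<Sum>i<m. \<Sum>j<n. (M $$ (i, j))\<^sup>2)"
  have pos: "euclid_norm_vec v > 0" if "v \<in> carrier_vec n" "v \<noteq> 0\<^sub>v n" for v
    using scalar_prod_self_pos[OF that] by (simp add: euclid_norm_vec_def)
  have "q v \<le> sqrt F" if v: "v \<in> carrier_vec n" "v \<noteq> 0\<^sub>v n" for v
  proof -
    have Mv: "M *\<^sub>v v \<in> carrier_vec m" using M v(1) by (rule mult_mat_vec_carrier)
    have "(M *\<^sub>v v) \<bullet> (M *\<^sub>v v) = (\<Sum>i<m. (\<Sum>j<n. M $$ (i, j) * v $ j)\<^sup>2)"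
      unfolding scalar_prod_self_eq_sum[OF Mv] using M v
      by (intro sum.cong) (auto simp: scalar_prod_def atLeast0LessThan)
    also have "\<dots> \<le> (\<Sum>i<m. (\<Sum>j<n. (M $$ (i, j))\<^sup>2) * (\<Sum>j<n. (v $ j)\<^sup>2))"
      by (intro sum_mono Cauchy_Schwarz_ineq_sum)
    also have "\<dots> = F * (v \<bullet> v)"
      unfolding F_def scalar_prod_self_eq_sum[OF v(1)] sum_distrib_right ..
    finally have "euclid_norm_vec (M *\<^sub>v v) \<le> sqrt F * euclid_norm_vec v"
      unfolding euclid_norm_vec_def by (simp flip: real_sqrt_mult)
    then show ?thesis using pos[OF v] by (simp add: q_def pos_divide_le_eq)
  qed
  then have "bdd_above (q ` (carrier_vec n - {0\<^sub>v n}))"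
    by (intro bdd_aboveI[of _ "sqrt F"]) auto
  then have "q x \<le> spectral_norm M"
    using M x False unfolding spectral_norm_def q_def by (auto intro!: cSUP_upper)
  then show ?thesis using pos[OF x False] by (simp add: q_def pos_divide_le_eq)
qed

lemma spectral_norm_nonneg:
  assumes M: "M \<in> carrier_mat m n" and "n > 0"
  shows "spectral_norm M \<ge> 0"
proof -
  have "euclid_norm_vec (unit_vec n 0) = 1"
    using \<open>n > 0\<close> by (simp add: euclid_norm_vec_def)
  then show ?thesis
    using spectral_norm_bound[OF M, of "unit_vec n 0"] euclid_norm_vec_nonneg[of "M *\<^sub>v unit_vec n 0"]
    by simp
qed

lemma transpose_smult_mat: "transpose_mat (c \<cdot>\<^sub>m K) = c \<cdot>\<^sub>m transpose_mat K"
  by (intro eq_matI) auto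

section \<open>Singular values of the all-at-once matrix\<close>

context
  fixes m n :: nat and \<tau> :: real and A P K M :: "real mat"
  assumes m: "m > 0" and n: "n > 0" and \<tau>: "\<tau> \<ge> 0" and A: "A \<in> carrier_mat n n"
  defines "P \<equiv> bdf2_mat m \<otimes>\<^sub>K 1\<^sub>m n" and "K \<equiv> 1\<^sub>m m \<otimes>\<^sub>K A"
    and "M \<equiv> all_at_once_mat \<tau> (bdf2_mat m) A"
begin

lemma P_carrier: "P \<in> carrier_mat (m * n) (m * n)"
  unfolding P_def by simp

lemma K_carrier: "K \<in> carrier_mat (m * n) (m * n)"
  unfolding K_def using A by simp

lemma M_eq: "M = P - \<tau> \<cdot>\<^sub>m K"
  using A unfolding M_def P_def K_def all_at_once_mat_def by (simp add: bdf2_mat_def)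

lemma M_carrier: "M \<in> carrier_mat (m * n) (m * n)"
  unfolding M_eq using P_carrier K_carrier by auto

text \<open>In the index k n + s, k is the time step and s the spatial node: \<open>P\<close> acts
  on the time series at each node by the scalar recursion.\<close>

lemma P_index:
  assumes "w \<in> carrier_vec (m * n)" "k < m" "s < n"
  shows "(P *\<^sub>v w) $ (k * n + s) = bdf2_step (\<lambda>j. w $ (j * n + s)) k"
proof -
  have "(P *\<^sub>v w) $ (k * n + s)
      = (\<Sum>j<m. \<Sum>t<n. bdf2_mat m $$ (k, j) * 1\<^sub>m n $$ (s, t) * w $ (j * n + t))"
    unfolding P_def using assms by (intro index_kronecker_prod_mult_vec) auto
  also have "\<dots> = (\<Sum>j<m. \<Sum>t<n. if t = s then bdf2_mat m $$ (k, j) * w $ (j * n + t) else 0)"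
    using assms by (intro sum.cong) auto
  also have "\<dots> = (\<Sum>j<m. bdf2_mat m $$ (k, j) * w $ (j * n + s))"
    using assms by simp
  finally show ?thesis using sum_bdf2_mat[OF \<open>k < m\<close>] by simp
qed

text \<open>Dually, \<open>K\<close> applies \<open>A\<close> to the spatial slice at each time
  step.\<close>

lemma K_index:
  assumes "w \<in> carrier_vec (m * n)" "k < m" "s < n"
  shows "(K *\<^sub>v w) $ (k * n + s) = (A *\<^sub>v vec n (\<lambda>t. w $ (k * n + t))) $ s"
proof -
  have "(K *\<^sub>v w) $ (k * n + s)
      = (\<Sum>j<m. \<Sum>t<n. 1\<^sub>m m $$ (k, j) * A $$ (s, t) * w $ (j * n + t))"
    unfolding K_def using assms A by (intro index_kronecker_prod_mult_vec) auto
  also have "\<dots> = (\<Sum>j<m. if j = k then \<Sum>t<n. A $$ (s, t) * w $ (j * n + t) else 0)"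
    using assms by (intro sum.cong) auto
  also have "\<dots> = (\<Sum>t<n. A $$ (s, t) * w $ (k * n + t))"
    using assms by simp
  finally show ?thesis using assms A by (simp add: scalar_prod_def atLeast0LessThan)
qed

lemma norm_P_le:
  assumes w: "w \<in> carrier_vec (m * n)"
  shows "euclid_norm_vec (P *\<^sub>v w) \<le> 4 * euclid_norm_vec w"
proof -
  have Pw: "P *\<^sub>v w \<in> carrier_vec (m * n)" using P_carrier w by (rule mult_mat_vec_carrier)
  have "(P *\<^sub>v w) \<bullet> (P *\<^sub>v w) = (\<Sum>s<n. \<Sum>k<m. (bdf2_step (\<lambda>j. w $ (j * n + s)) k)\<^sup>2)"
    unfolding scalar_prod_self_eq_sum[OF Pw] sum_lessThan_mult
    \<comment> \<open>The swap makes time the inner sum, so that the scalar bound applies node by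
      node.\<close>
    by (subst sum.swap) (simp add: P_index[OF w] del: index_mult_mat_vec)
  also have "\<dots> \<le> (\<Sum>s<n. 16 * (\<Sum>k<m. (w $ (k * n + s))\<^sup>2))"
    by (intro sum_mono bdf2_step_square_sum_le)
  also have "\<dots> = 4\<^sup>2 * (w \<bullet> w)"
    unfolding scalar_prod_self_eq_sum[OF w] sum_lessThan_mult
    by (subst sum.swap) (simp add: sum_distrib_left)
  finally have "(euclid_norm_vec (P *\<^sub>v w))\<^sup>2 \<le> (4 * euclid_norm_vec w)\<^sup>2"
    by (simp add: euclid_norm_vec_square power_mult_distrib)
  then show ?thesis
    by (rule power2_le_imp_le) (simp add: euclid_norm_vec_nonneg)
qed

lemma norm_K_le:
  assumes w: "w \<in> carrier_vec (m * n)"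
  shows "euclid_norm_vec (K *\<^sub>v w) \<le> spectral_norm A * euclid_norm_vec w"
proof -
  have Kw: "K *\<^sub>v w \<in> carrier_vec (m * n)" using K_carrier w by (rule mult_mat_vec_carrier)
  define b where "b k = vec n (\<lambda>t. w $ (k * n + t))" for k
  have b: "b k \<in> carrier_vec n" for k by (simp add: b_def)
  have Ab: "A *\<^sub>v b k \<in> carrier_vec n" for k using A b by (rule mult_mat_vec_carrier)
  have "(K *\<^sub>v w) \<bullet> (K *\<^sub>v w) = (\<Sum>k<m. (A *\<^sub>v b k) \<bullet> (A *\<^sub>v b k))"
    unfolding scalar_prod_self_eq_sum[OF Kw] sum_lessThan_mult scalar_prod_self_eq_sum[OF Ab]
    by (simp add: K_index[OF w] b_def del: index_mult_mat_vec)
  also have "\<dots> \<le> (\<Sum>k<m. (spectral_norm A)\<^sup>2 * (b k \<bullet> b k))"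
    unfolding euclid_norm_vec_square[symmetric] power_mult_distrib[symmetric]
    by (intro sum_mono power_mono spectral_norm_bound[OF A b] euclid_norm_vec_nonneg)
  also have "\<dots> = (spectral_norm A)\<^sup>2 * (w \<bullet> w)"
    unfolding scalar_prod_self_eq_sum[OF w] sum_lessThan_mult scalar_prod_self_eq_sum[OF b]
    by (simp add: b_def sum_distrib_left)
  finally have "(euclid_norm_vec (K *\<^sub>v w))\<^sup>2 \<le> (spectral_norm A * euclid_norm_vec w)\<^sup>2"
    by (simp add: euclid_norm_vec_square power_mult_distrib)
  then show ?thesis
    by (rule power2_le_imp_le) (simp add: euclid_norm_vec_nonneg spectral_norm_nonneg[OF A n])
qed

lemma eigenvalue_gram_le:
  assumes "eigenvalue (transpose_mat M * M) \<mu>"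
  shows "sqrt \<mu> \<le> 4 + \<tau> * spectral_norm A"
proof -
  obtain v where ev: "eigenvector (transpose_mat M * M) v \<mu>"
    using assms unfolding eigenvalue_def by blast
  then have v: "v \<in> carrier_vec (m * n)" "v \<noteq> 0\<^sub>v (m * n)"
    using M_carrier unfolding eigenvector_def by auto
  have pos: "euclid_norm_vec v > 0"
    using scalar_prod_self_pos[OF v] by (simp add: euclid_norm_vec_def)
  have "sqrt \<mu> * euclid_norm_vec v = euclid_norm_vec (M *\<^sub>v v)"
    using eigenvector_gram[OF M_carrier ev] unfolding euclid_norm_vec_def
    by (simp flip: real_sqrt_mult)
  also have "M *\<^sub>v v = P *\<^sub>v v - \<tau> \<cdot>\<^sub>v (K *\<^sub>v v)"
    unfolding M_eq using P_carrier K_carrier v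
    by (subst minus_mult_distrib_mat_vec[of _ "m * n" "m * n"]) auto
  also have "euclid_norm_vec \<dots> \<le> euclid_norm_vec (P *\<^sub>v v) + \<tau> * euclid_norm_vec (K *\<^sub>v v)"
    using P_carrier K_carrier v(1) \<tau>
    by (intro euclid_norm_vec_minus_smult_le[of _ "m * n"] mult_mat_vec_carrier)
  also have "\<dots> \<le> 4 * euclid_norm_vec v + \<tau> * (spectral_norm A * euclid_norm_vec v)"
    using norm_P_le[OF v(1)] norm_K_le[OF v(1)] \<tau> by (intro add_mono mult_left_mono)
  also have "\<dots> = (4 + \<tau> * spectral_norm A) * euclid_norm_vec v"
    by (simp add: algebra_simps)
  finally show ?thesis using pos by simp
qed

text \<open>\<open>X \<otimes>\<^sub>K 1\<^sub>m n\<close> and \<open>K\<close> multiply to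
  \<open>X \<otimes>\<^sub>K A\<close> in either order, so \<open>K\<close> commutes with
  \<open>P\<close> and its transpose. As \<open>K\<close> is symmetric, \<open>M\<close> and its
  transpose differ from these by a multiple of \<open>K\<close> and commute with \<open>K\<close>
  too.\<close>

lemma K_commutes_gram:
  assumes sym: "transpose_mat A = A"
  shows "(transpose_mat M * M) * K = K * (transpose_mat M * M)"
proof -
  let ?N = "m * n"
  have Kt: "transpose_mat K = K"
    unfolding K_def transpose_kronecker_prod sym by simp
  have Pt: "transpose_mat P = transpose_mat (bdf2_mat m) \<otimes>\<^sub>K 1\<^sub>m n"
    unfolding P_def transpose_kronecker_prod by simp
  have Ptc: "transpose_mat P \<in> carrier_mat ?N ?N" using P_carrier by simp
  have comm: "(X \<otimes>\<^sub>K 1\<^sub>m n) * K = K * (X \<otimes>\<^sub>K 1\<^sub>m n)" if X: "X \<in> carrier_mat m m" for X :: "real mat"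
    unfolding K_def using X A
      kronecker_prod_mult[OF X one_carrier_mat[of n] one_carrier_mat[of m] A]
      kronecker_prod_mult[OF one_carrier_mat[of m] A X one_carrier_mat[of n]] by simp
  have PK: "P * K = K * P" unfolding P_def by (rule comm) simp
  have PtK: "transpose_mat P * K = K * transpose_mat P" unfolding Pt by (rule comm) simp
  have tK: "\<tau> \<cdot>\<^sub>m K \<in> carrier_mat ?N ?N" using K_carrier by simp
  have tKK: "(\<tau> \<cdot>\<^sub>m K) * K = K * (\<tau> \<cdot>\<^sub>m K)"
    using K_carrier by (simp add: mult_smult_distrib[of _ ?N ?N _ ?N] mult_smult_assoc_mat[of _ ?N ?N _ ?N])
  have MK: "M * K = K * M"
    unfolding M_eq minus_mult_distrib_mat[OF P_carrier tK K_carrier]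
      mult_minus_distrib_mat[OF K_carrier P_carrier tK] PK tKK ..
  have Mt: "transpose_mat M = transpose_mat P - \<tau> \<cdot>\<^sub>m K"
    unfolding M_eq transpose_minus[OF P_carrier tK] using Kt
    by (metis transpose_smult_mat)
  have MtK: "transpose_mat M * K = K * transpose_mat M"
    unfolding Mt minus_mult_distrib_mat[OF Ptc tK K_carrier]
      mult_minus_distrib_mat[OF K_carrier Ptc tK] PtK tKK ..
  have Mtc: "transpose_mat M \<in> carrier_mat ?N ?N" using M_carrier by simp
  show ?thesis
    using assoc_mult_mat[OF Mtc M_carrier K_carrier] assoc_mult_mat[OF Mtc K_carrier M_carrier]
      assoc_mult_mat[OF K_carrier Mtc M_carrier] MK MtK by simp
qed

lemma eigenvalue_gram_ge:
  assumes sym: "transpose_mat A = A" and neg: "\<And>\<theta>. eigenvalue A \<theta> \<Longrightarrow> \<theta> \<le> 0"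
    and ev: "eigenvalue (transpose_mat M * M) \<mu>"
  shows "sqrt 6 / (3 * real m) \<le> sqrt \<mu>"
proof -
  have G: "transpose_mat M * M \<in> carrier_mat (m * n) (m * n)" using M_carrier by auto
  have Kt: "transpose_mat K = K"
    unfolding K_def transpose_kronecker_prod sym by simp
  obtain w \<theta> where w: "eigenvector (transpose_mat M * M) w \<mu>" "eigenvector K w \<theta>"
    using commuting_symmetric_joint_eigenvector[OF G K_carrier Kt K_commutes_gram[OF sym] ev] .
  then have wc: "w \<in> carrier_vec (m * n)" "w \<noteq> 0\<^sub>v (m * n)" and Kw: "K *\<^sub>v w = \<theta> \<cdot>\<^sub>v w"
    using K_carrier unfolding eigenvector_def by auto
  \<comment> \<open>Every nonzero time slice of w is an eigenvector of \<open>A\<close> for the same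
    \<theta>; the slice through a nonzero entry of w is one.\<close>
  have "eigenvalue A \<theta>"
  proof -
    define b where "b k = vec n (\<lambda>t. w $ (k * n + t))" for k
    obtain i where i: "i < m * n" "w $ i \<noteq> 0"
      using wc by (metis carrier_vecD eq_vecI index_zero_vec)
    let ?k = "i div n"
    have k: "?k < m" "i mod n < n" using i n by (auto simp: less_mult_imp_div_less)
    have "b ?k $ (i mod n) \<noteq> 0" using i k by (simp add: b_def)
    then have "b ?k \<noteq> 0\<^sub>v n" using k(2) by auto
    moreover have "A *\<^sub>v b ?k = \<theta> \<cdot>\<^sub>v b ?k"
    proof (rule eq_vecI)
      fix s assume "s < dim_vec (\<theta> \<cdot>\<^sub>v b ?k)"
      then have s: "s < n" by (simp add: b_def)
      have "(A *\<^sub>v b ?k) $ s = (K *\<^sub>v w) $ (?k * n + s)"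
        unfolding K_index[OF wc(1) k(1) s] b_def ..
      also have "\<dots> = (\<theta> \<cdot>\<^sub>v b ?k) $ s"
        unfolding Kw using s wc mult_add_less_mult[OF k(1) s] by (simp add: b_def)
      finally show "(A *\<^sub>v b ?k) $ s = (\<theta> \<cdot>\<^sub>v b ?k) $ s" .
    qed (use A in \<open>simp add: b_def\<close>)
    moreover have "b ?k \<in> carrier_vec n" by (simp add: b_def)
    ultimately show ?thesis
      using A unfolding eigenvalue_def eigenvector_def by auto
  qed
  then have "\<theta> \<le> 0" by (rule neg)
  \<comment> \<open>This number plays the part of the \<mu> in \<open>bdf2_stable\<close>; here
    \<mu> denotes the squared singular value.\<close>
  then have nonneg: "- (\<tau> * \<theta>) \<ge> 0" using \<tau> by (simp add: mult_nonneg_nonpos)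
  have Mw: "M *\<^sub>v w \<in> carrier_vec (m * n)" using M_carrier wc(1) by (rule mult_mat_vec_carrier)
  define x where "x s k = w $ (k * n + s)" for s k
  define f where "f s k = bdf2_step (x s) k + - (\<tau> * \<theta>) * x s k" for s k
  have f: "(M *\<^sub>v w) $ (k * n + s) = f s k" if ks: "k < m" "s < n" for k s
  proof -
    have "M *\<^sub>v w = P *\<^sub>v w - \<tau> \<cdot>\<^sub>v (K *\<^sub>v w)"
      unfolding M_eq using P_carrier K_carrier wc
      by (subst minus_mult_distrib_mat_vec[of _ "m * n" "m * n"]) auto
    then have "M *\<^sub>v w = P *\<^sub>v w - (\<tau> * \<theta>) \<cdot>\<^sub>v w"
      unfolding Kw by (simp add: smult_smult_assoc)
    then have "(M *\<^sub>v w) $ (k * n + s) = (P *\<^sub>v w) $ (k * n + s) - \<tau> * \<theta> * w $ (k * n + s)"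
      using mult_add_less_mult[OF ks] wc P_carrier by (simp del: index_mult_mat_vec)
    then show ?thesis unfolding P_index[OF wc(1) ks] f_def x_def by simp
  qed
  have "w \<bullet> w = (\<Sum>s<n. \<Sum>k<m. (x s k)\<^sup>2)"
    unfolding scalar_prod_self_eq_sum[OF wc(1)] sum_lessThan_mult x_def by (rule sum.swap)
  \<comment> \<open>The constant of the scalar estimate is the same at all nodes, so it survives the
    sum over s.\<close>
  also have "\<dots> \<le> (\<Sum>s<n. 3 / 2 * (real m)\<^sup>2 * (\<Sum>k<m. (f s k)\<^sup>2))"
    by (intro sum_mono bdf2_stable[OF nonneg]) (simp add: f_def)
  also have "\<dots> = 3 / 2 * (real m)\<^sup>2 * ((M *\<^sub>v w) \<bullet> (M *\<^sub>v w))"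
    unfolding scalar_prod_self_eq_sum[OF Mw] sum_lessThan_mult sum_distrib_left
    by (subst (2) sum.swap) (simp add: f del: index_mult_mat_vec)
  also have "\<dots> = 3 / 2 * (real m)\<^sup>2 * \<mu> * (w \<bullet> w)"
    using eigenvector_gram[OF M_carrier w(1)] by simp
  finally have "1 \<le> 3 / 2 * (real m)\<^sup>2 * \<mu>"
    using scalar_prod_self_pos[OF wc] by simp
  \<comment> \<open>The factor 2/3 is written as 6/9 so that the root takes the required
    form.\<close>
  then have "6 / (9 * (real m)\<^sup>2) \<le> \<mu>" using m by (simp add: field_simps)
  then have "sqrt (6 / (9 * (real m)\<^sup>2)) \<le> sqrt \<mu>" by simp
  then show ?thesis unfolding real_sqrt_divide real_sqrt_mult by simp
qed

lemma singular_values_subset: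
  assumes "transpose_mat A = A" and "\<And>\<theta>. eigenvalue A \<theta> \<Longrightarrow> \<theta> \<le> 0"
  shows "singular_values M \<subseteq> {sqrt 6 / (3 * real m) .. 4 + \<tau> * spectral_norm A}"
  using eigenvalue_gram_le eigenvalue_gram_ge[OF assms]
  by (auto simp: singular_values_def spectrum_def)

text \<open>Without both facts, Max and Min in \<open>sigma_max\<close> and \<open>sigma_min\<close>
  would not be known to be singular values.\<close>

lemma finite_singular_values: "finite (singular_values M)"
  and singular_values_nonempty: "singular_values M \<noteq> {}"
proof -
  have G: "transpose_mat M * M \<in> carrier_mat (m * n) (m * n)" using M_carrier by auto
  then show "finite (singular_values M)"
    unfolding singular_values_def by (intro finite_imageI card_finite_spectrum)
  have "transpose_mat (transpose_mat M * M) = transpose_mat M * M"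
    using M_carrier by (subst transpose_mult[of _ "m * n" "m * n"]) auto
  from symmetric_eigenvalue_exists[OF G this]
  show "singular_values M \<noteq> {}"
    using m n by (auto simp: singular_values_def spectrum_def)
qed

end

section \<open>Symmetry of the Jacobian matrix, and the condition number\<close>

text \<open>A sign change of l swaps the two Gamma factors, and each power of -1 is its own
  inverse.\<close>

lemma riesz_weight_minus: "riesz_weight \<gamma> (- l) = riesz_weight \<gamma> l"
  by (simp add: riesz_weight_def power_int_minus mult.commute flip: power_int_inverse)

lemma transpose_jacobian_mat: "transpose_mat (jacobian_mat a b \<kappa> \<gamma> N) = jacobian_mat a b \<kappa> \<gamma> N"
proof -
  have "riesz_weight \<gamma> (int j - int i) = riesz_weight \<gamma> (int i - int j)" for i j
    using riesz_weight_minus[of \<gamma> "int i - int j"] by simp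
  then show ?thesis by (auto intro!: eq_matI simp: jacobian_mat_def Let_def)
qed

theorem theorem2p1:
  fixes a b T \<kappa> \<gamma> \<tau> :: real and N Nt :: nat and A C AA :: "real mat"
  assumes "a < b" and "T > 0" and "\<kappa> > 0" and "1 < \<gamma>" and "\<gamma> < 2"
    and "N \<ge> 2" and "Nt \<ge> 1"
    and "\<tau> = T / real Nt"
    and "A = jacobian_mat a b \<kappa> \<gamma> N"
    and "C = bdf2_mat Nt"
    and "AA = all_at_once_mat \<tau> C A"
    and "\<And>z :: complex. eigenvalue (map_mat complex_of_real A) z \<Longrightarrow> Re z \<le> 0"
  shows "sigma_max AA \<le> 4 + \<tau> * spectral_norm A
       \<and> sigma_min AA \<ge> sqrt 6 / (3 * real Nt)
       \<and> cond_number AA \<le> 2 * sqrt 6 * real Nt + sqrt 6 * T * spectral_norm A / 2"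
proof -
  have A: "A \<in> carrier_mat (N - 1) (N - 1)"
    using assms(9) by (simp add: jacobian_mat_def Let_def)
  have sym: "transpose_mat A = A"
    using assms(9) by (simp add: transpose_jacobian_mat)
  have \<tau>: "\<tau> \<ge> 0" using assms by simp
  have pos: "Nt > 0" "N - 1 > 0" using assms by auto
  \<comment> \<open>A real eigenvalue of \<open>A\<close> is also one of its complexification, and
    equals its own real part.\<close>
  have neg: "\<theta> \<le> 0" if "eigenvalue A \<theta>" for \<theta>
    using assms(12)[OF of_real_hom.eigenvalue_hom[OF A that]] by simp
  define l u where "l = sqrt 6 / (3 * real Nt)" and "u = 4 + \<tau> * spectral_norm A"
  have AA: "AA = all_at_once_mat \<tau> (bdf2_mat Nt) A" using assms by simp
  have sub: "singular_values AA \<subseteq> {l..u}"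
    unfolding AA l_def u_def by (rule singular_values_subset[OF pos \<tau> A sym neg])
  have fin: "finite (singular_values AA)" and ne: "singular_values AA \<noteq> {}"
    unfolding AA using finite_singular_values[OF pos \<tau> A] singular_values_nonempty[OF pos \<tau> A]
    by auto
  have max: "sigma_max AA \<in> {l..u}" and min: "sigma_min AA \<in> {l..u}"
    using Max_in[OF fin ne] Min_in[OF fin ne] sub unfolding sigma_max_def sigma_min_def by auto
  have l: "l > 0" using pos by (simp add: l_def)
  \<comment> \<open>Both extreme singular values lie between l > 0 and u, so the quotient is largest
    at u over l.\<close>
  have "cond_number AA \<le> u / l"
    unfolding cond_number_def using max min l by (intro frac_le) auto
  \<comment> \<open>Verified after multiplication by l, where the two roots of 6 combine: 6 * 2/3 =
    4, and 6 * 1/6 leaves \<tau> times the norm.\<close>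
  also have "u / l = 2 * sqrt 6 * real Nt + sqrt 6 * T * spectral_norm A / 2"
  proof -
    have "u / l * l = u" using l by simp
    moreover have "(2 * sqrt 6 * real Nt + sqrt 6 * T * spectral_norm A / 2) * l
        = (sqrt 6)\<^sup>2 * (2 / 3 + T / real Nt * spectral_norm A / 6)"
      using pos by (simp add: l_def field_simps power2_eq_square)
    then have "(2 * sqrt 6 * real Nt + sqrt 6 * T * spectral_norm A / 2) * l = u"
      unfolding u_def assms(8) by simp
    ultimately show ?thesis using l by (metis mult_right_cancel less_irrefl)
  qed
  finally show ?thesis using max min unfolding l_def u_def by simp
qed

end
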